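(* Let $(X, N, \phi, K, * )$ be a fuzzy strong $\phi$-b-normed linear space over $\mathbb{R}$ such that $X$ is finite dimensional and the underlying $t$-norm $*$ is continuous at $(1,1)$. Then $(X, N, \phi, K, * )$ is complete, i.e., every Cauchy sequence in $X$ converges to some element of $X$.
   Context: A $t$-norm is a binary operation $* : [0,1] \times [0,1] \to [0,1]$ that is associative and commutative, satisfies $\alpha * 1 = \alpha$ for all $\alpha \in [0,1]$, and satisfies $\alpha * \gamma \leq \beta * \delta$ whenever $\alpha \leq \beta$ and $\gamma \leq \delta$. Let $\phi : \mathbb{R} \to \mathbb{R}$ be a function with the following properties: ($\phi$1) $\phi(-t) = \phi(t)$ for all $t \in \mathbb{R}$; ($\phi$2) $\phi(1) = 1$; ($\phi$3) $\phi$ is strictly increasing and continuous on $(0,\infty)$; ($\phi$4) $\lim_{\alpha \to 0} \phi(\alpha) = 0$ and $\lim_{\alpha \to \infty} \phi(\alpha) = \infty$. Let $X$ be a real linear space with zero vector $\theta$, let $K \geq 1$ be a given real number, and let $*$ be a $t$-norm. A fuzzy subset $N$ of $X \times \mathbb{R}$ (that is, a function $N : X \times \mathbb{R} \to [0,1]$) is called a fuzzy strong $\phi$-b-norm on $X$ if for all $x, y \in X$: (bN1) $N(x,t) = 0$ for all $t \in \mathbb{R}$ with $t \leq 0$; (bN2) ($N(x,t) = 1$ for all $t > 0$) if and only if $x = \theta$; (bN3) for all $t > 0$ and all scalars $c$ with $\phi(c) \neq 0$, $N(cx,t) = N\left(x, \frac{t}{\phi(c)}\right)$; (bN4) for all $s,t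 \in \mathbb{R}$, $N(x+y, s+Kt) \geq N(x,s) * N(y,t)$; (bN5) $N(x,\cdot)$ is a non-decreasing function of $t$ and $\lim_{t \to \infty} N(x,t) = 1$. Then $(X, N, \phi, K, * )$ is called a fuzzy strong $\phi$-b-normed linear space. A sequence $\{x_n\}$ in $X$ converges to $x \in X$ if $\lim_{n \to \infty} N(x_n - x, t) = 1$ for all $t > 0$. A sequence $\{x_n\}$ in $X$ is Cauchy if $\lim_{n \to \infty} N(x_{n+p} - x_n, t) = 1$ for all $t > 0$ and $p = 1, 2, \dots$.
   Formalization: A Cauchy sequence is taken to satisfy lim N(x_{n+p} − x_n, t) = 1 uniformly in p for each t > 0; with a separate limit for each p the claim is false (harmonic partial sums in ℝ with N(x,t) = t/(t+|x|), φ = |·|, K = 1, * = min). *)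

theory Defs
  imports "HOL-Analysis.Analysis"
begin

locale t_norm =
  fixes T :: "real \<Rightarrow> real \<Rightarrow> real"
  assumes closed: "\<lbrakk>a \<in> {0..1}; b \<in> {0..1}\<rbrakk> \<Longrightarrow> T a b \<in> {0..1}"
    and assoc: "\<lbrakk>a \<in> {0..1}; b \<in> {0..1}; c \<in> {0..1}\<rbrakk> \<Longrightarrow> T (T a b) c = T a (T b c)"
    and commute: "\<lbrakk>a \<in> {0..1}; b \<in> {0..1}\<rbrakk> \<Longrightarrow> T a b = T b a"
    and unit: "a \<in> {0..1} \<Longrightarrow> T a 1 = a"
    and mono: "\<lbrakk>a \<in> {0..1}; b \<in> {0..1}; c \<in> {0..1}; d \<in> {0..1}; a \<le> b; c \<le> d\<rbrakk>
                 \<Longrightarrow> T a c \<le> T b d"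

locale phi_function =
  fixes \<phi> :: "real \<Rightarrow> real"
  assumes even: "\<phi> (- t) = \<phi> t"
    and one: "\<phi> 1 = 1"
    and strict_mono: "strict_mono_on {0<..} \<phi>"
    and continuous: "continuous_on {0<..} \<phi>"
    and tendsto_0: "(\<phi> \<longlongrightarrow> 0) (at 0)"
    and tendsto_infinity: "filterlim \<phi> at_top at_top"

locale fuzzy_strong_phi_b_normed_space =
  fixes N :: "'a::real_vector \<Rightarrow> real \<Rightarrow> real"
    and \<phi> :: "real \<Rightarrow> real"
    and K :: real
    and T :: "real \<Rightarrow> real \<Rightarrow> real"
  assumes phi_function: "phi_function \<phi>"
    and K_ge_1: "K \<ge> 1"
    and t_norm: "t_norm T"
    and N_range: "N x t \<in> {0..1}"
    and bN1: "t \<le> 0 \<Longrightarrow> N x t = 0"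
    and bN2: "(\<forall>t>0. N x t = 1) \<longleftrightarrow> x = 0"
    and bN3: "\<lbrakk>t > 0; \<phi> c \<noteq> 0\<rbrakk> \<Longrightarrow> N (c *\<^sub>R x) t = N x (t / \<phi> c)"
    and bN4: "N (x + y) (s + K * t) \<ge> T (N x s) (N y t)"
    and bN5_mono: "mono (N x)"
    and bN5_tendsto: "(N x \<longlongrightarrow> 1) at_top"

definition fuzzy_converges ::
  "('a::real_vector \<Rightarrow> real \<Rightarrow> real) \<Rightarrow> (nat \<Rightarrow> 'a) \<Rightarrow> 'a \<Rightarrow> bool" where
  "fuzzy_converges N x l \<longleftrightarrow> (\<forall>t>0. (\<lambda>n. N (x n - l) t) \<longlonglongrightarrow> 1)"

(* The limit as n tends to infinity is uniform in p. With a separate limit for each p the notion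
   would be too weak for completeness, even on the real line: for N x t = t / (t + \<bar>x\<bar>) (t > 0),
   \<phi> = abs, K = 1, T = min, the partial sums of the harmonic series satisfy
   N (x (n + p) - x n) t \<longlonglongrightarrow> 1 for each fixed p but do not converge. *)
definition fuzzy_Cauchy ::
  "('a::real_vector \<Rightarrow> real \<Rightarrow> real) \<Rightarrow> (nat \<Rightarrow> 'a) \<Rightarrow> bool" where
  "fuzzy_Cauchy N x \<longleftrightarrow>
     (\<forall>t>0. uniform_limit {1..} (\<lambda>n p. N (x (n + p) - x n) t) (\<lambda>p. 1) sequentially)"

definition fuzzy_complete :: "('a::real_vector \<Rightarrow> real \<Rightarrow> real) \<Rightarrow> bool" where
  "fuzzy_complete N \<longleftrightarrow> (\<forall>x. fuzzy_Cauchy N x \<longrightarrow> (\<exists>l. fuzzy_converges N x l))"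

end

theory Submission
  imports Defs
begin

text \<open>
  Continuity of the t-norm at \<open>(1, 1)\<close> makes the sequences (or nets) that are null for \<open>N\<close> closed
  under addition, and \<open>\<phi>\<close> controls scalar multiplication, so the classical argument for Hausdorff
  topological vector spaces applies: completeness of \<open>span B\<close> goes by induction on the
  finite set \<open>B\<close>. Write a Cauchy sequence in \<open>span (insert b B)\<close> as \<open>x n = a n *\<^sub>R b + y n\<close> with
  \<open>y n \<in> span B\<close> and \<open>b \<notin> span B\<close>. If \<open>a\<close> were not Cauchy, dividing suitable differences of \<open>x\<close> by
  the corresponding differences of \<open>a\<close> would give a null sequence \<open>b + w k\<close> with \<open>w k \<in> span B\<close>;
  since \<open>span B\<close> is complete, \<open>- b = lim w\<close> would lie in \<open>span B\<close>. Hence \<open>a\<close> converges, so \<open>y\<close> is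
  Cauchy and converges, and so does \<open>x\<close>.
\<close>

section \<open>Positivity and monotonicity of \<phi> away from 0\<close>

lemma (in phi_function) pos:
  assumes "c \<noteq> 0"
  shows "\<phi> c > 0"
proof -
  have "\<phi> r > 0" if "r > 0" for r
  proof -
    \<comment> \<open>The intermediate point \<open>r / 2\<close> bounds the values near 0, hence
      also their limit 0; strictness is regained in passing from \<open>r / 2\<close> to
      \<open>r\<close>.\<close>
    have "\<phi> s \<le> \<phi> (r / 2)" if "s > 0" "s < r / 2" for s
      using strict_mono_onD[OF strict_mono, of s "r / 2"] that by auto
    then have "eventually (\<lambda>s. \<phi> s \<le> \<phi> (r / 2)) (at_right 0)"
      using \<open>r > 0\<close> by (auto simp: eventually_at_right_field intro!: exI[of _ "r / 2"])
    moreover have "(\<phi> \<longlongrightarrow> 0) (at_right 0)"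
      using tendsto_0 filterlim_at_split by blast
    ultimately have "0 \<le> \<phi> (r / 2)"
      by (intro tendsto_upperbound[of \<phi> 0 "at_right 0"]) auto
    also have "\<phi> (r / 2) < \<phi> r"
      using strict_mono_onD[OF strict_mono, of "r / 2" r] that by auto
    finally show ?thesis .
  qed
  from this[of c] this[of "- c"] show ?thesis
    using assms even[of c] by (cases "c > 0") auto
qed

lemma (in phi_function) mono_abs:
  assumes "c \<noteq> 0" "\<bar>c\<bar> \<le> C"
  shows "\<phi> c \<le> \<phi> C"
proof -
  have "C > 0"
    using assms by linarith
  have "\<phi> \<bar>c\<bar> = \<phi> c"
    using even[of c] by (simp add: abs_if)
  moreover have "\<phi> \<bar>c\<bar> \<le> \<phi> C"
    using strict_mono_onD[OF strict_mono, of "\<bar>c\<bar>" C] assms \<open>C > 0\<close>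
    by (cases "\<bar>c\<bar> = C") auto
  ultimately show ?thesis by simp
qed

section \<open>Families that are null for \<open>N\<close>\<close>

locale fuzzy_normed_space_cont = fuzzy_strong_phi_b_normed_space N \<phi> K T
  for N :: "'a::real_vector \<Rightarrow> real \<Rightarrow> real" and \<phi> K T +
  assumes T_cont: "continuous (at (1, 1) within {0..1} \<times> {0..1}) (\<lambda>(a, b). T a b)"
begin

sublocale phi: phi_function \<phi>
  by (rule phi_function)

sublocale tn: t_norm T
  by (rule t_norm)

text \<open>The filter is arbitrary so that the same rules serve sequences, double sequences and
  limits in a scalar.\<close>

definition null :: "('i \<Rightarrow> 'a) \<Rightarrow> 'i filter \<Rightarrow> bool" where
  "null z F \<longleftrightarrow> (\<forall>t>0. ((\<lambda>i. N (z i) t) \<longlongrightarrow> 1) F)"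

definition Cauchy_seq :: "(nat \<Rightarrow> 'a) \<Rightarrow> bool" where
  "Cauchy_seq x \<longleftrightarrow> null (\<lambda>p. x (fst p) - x (snd p)) (sequentially \<times>\<^sub>F sequentially)"

lemma N_le_1: "N x t \<le> 1"
  using N_range[of x t] by simp

lemma N_zero: "t > 0 \<Longrightarrow> N 0 t = 1"
  using bN2[of 0] by auto

lemma N_uminus: "N (- x) t = N x t"
proof (cases "t > 0")
  case True
  have "\<phi> (- 1) = 1"
    using phi.even[of 1] phi.one by simp
  then show ?thesis
    using bN3[OF True, of "- 1" x] by simp
qed (use bN1[of t] in auto)

lemma N_mono: "s \<le> t \<Longrightarrow> N x s \<le> N x t"
  using bN5_mono by (rule monoD)

text \<open>For \<open>c \<noteq> 0\<close>, monotonicity of \<phi> turns \<open>bN3\<close> into a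
  bound uniform in \<open>c\<close>. The case \<open>c = 0\<close> needs \<open>N_zero\<close>
  instead, since nothing is known about \<open>\<phi> 0\<close>.\<close>

lemma N_scaleR_ge:
  assumes "t > 0" "\<bar>c\<bar> \<le> C" "C > 0"
  shows "N x (t / \<phi> C) \<le> N (c *\<^sub>R x) t"
proof (cases "c = 0")
  case True
  then show ?thesis using N_zero[OF assms(1)] N_le_1 by simp
next
  case False
  have "t / \<phi> C \<le> t / \<phi> c"
    using phi.mono_abs[OF False assms(2)] phi.pos[OF False] assms(1)
    by (intro divide_left_mono) auto
  then show ?thesis
    using bN3[OF assms(1), of c x] phi.pos[OF False] N_mono by simp
qed

lemma null_const:
  assumes "null (\<lambda>_. x) F" "F \<noteq> bot"
  shows "x = 0"
  using assms bN2[of x] unfolding null_def by (simp add: tendsto_const_iff)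

lemma null_compose:
  assumes "null z G" "filterlim f G F"
  shows "null (\<lambda>i. z (f i)) F"
  using assms unfolding null_def by (auto intro: filterlim_compose)

lemma null_uminus: "null z F \<Longrightarrow> null (\<lambda>i. - z i) F"
  unfolding null_def by (simp add: N_uminus)

text \<open>\<open>N\<close> never exceeds 1, so a squeeze needs only the lower bound.\<close>

lemma null_ge:
  assumes "\<And>t. t > 0 \<Longrightarrow> (g t \<longlongrightarrow> 1) F"
    and "\<And>t. t > 0 \<Longrightarrow> eventually (\<lambda>i. g t i \<le> N (z i) t) F"
  shows "null z F"
  unfolding null_def
proof (intro allI impI)
  fix t :: real assume "t > 0"
  then show "((\<lambda>i. N (z i) t) \<longlongrightarrow> 1) F"
    by (intro tendsto_sandwich[OF assms(2) _ assms(1) tendsto_const]) (auto simp: N_le_1)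
qed

lemma null_add:
  assumes "null y F" "null z F"
  shows "null (\<lambda>i. y i + z i) F"
proof (rule null_ge)
  fix t :: real assume "t > 0"
  have K: "K > 0" using K_ge_1 by simp
  \<comment> \<open>The second argument is scaled by \<open>1 / K\<close> so that \<open>bN4\<close>
    recombines the two halves into exactly \<open>t\<close>.\<close>
  have "((\<lambda>i. N (y i) (t / 2)) \<longlongrightarrow> 1) F" "((\<lambda>i. N (z i) (t / (2 * K))) \<longlongrightarrow> 1) F"
    using assms \<open>t > 0\<close> K unfolding null_def by auto
  then have "((\<lambda>i. (N (y i) (t / 2), N (z i) (t / (2 * K)))) \<longlongrightarrow> (1, 1)) F"
    by (rule tendsto_Pair)
  from continuous_within_tendsto_compose[OF T_cont _ this]
  show "((\<lambda>i. T (N (y i) (t / 2)) (N (z i) (t / (2 * K)))) \<longlongrightarrow> 1) F"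
    using N_range tn.unit[of 1] by simp
  show "eventually (\<lambda>i. T (N (y i) (t / 2)) (N (z i) (t / (2 * K))) \<le> N (y i + z i) t) F"
  proof (rule always_eventually, rule allI)
    fix i
    have "t / 2 + K * (t / (2 * K)) = t"
      using K by (simp add: field_simps)
    then show "T (N (y i) (t / 2)) (N (z i) (t / (2 * K))) \<le> N (y i + z i) t"
      using bN4[of "y i" "t / 2" "z i" "t / (2 * K)"] by simp
  qed
qed

lemma null_diff: "null y F \<Longrightarrow> null z F \<Longrightarrow> null (\<lambda>i. y i - z i) F"
  using null_add[of y F "\<lambda>i. - z i"] null_uminus[of z F] by simp

lemma null_scaleR_bounded:
  assumes "null z F" "\<And>i. \<bar>c i\<bar> \<le> C" "C > 0"
  shows "null (\<lambda>i. c i *\<^sub>R z i) F"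
proof (rule null_ge)
  fix t :: real assume "t > 0"
  then show "((\<lambda>i. N (z i) (t / \<phi> C)) \<longlongrightarrow> 1) F"
    using assms(1) phi.pos[of C] \<open>C > 0\<close> unfolding null_def by simp
  show "eventually (\<lambda>i. N (z i) (t / \<phi> C) \<le> N (c i *\<^sub>R z i) t) F"
    using N_scaleR_ge[OF \<open>t > 0\<close> assms(2,3)] by (rule eventuallyI)
qed

text \<open>As \<open>r\<close> tends to 0, \<open>t / \<phi> r\<close> tends to infinity, where
  \<open>N b\<close> tends to 1.\<close>

lemma null_scaleR_left:
  assumes "(c \<longlongrightarrow> 0) F"
  shows "null (\<lambda>i. c i *\<^sub>R b) F"
proof -
  have "null (\<lambda>r. r *\<^sub>R b) (at 0)"
    unfolding null_def
  proof (intro allI impI)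
    fix t :: real assume "t > 0"
    have nz: "eventually (\<lambda>r. r \<noteq> 0) (at (0::real))"
      by (simp add: eventually_at_filter)
    have "eventually (\<lambda>r. \<phi> r > 0) (at 0)"
      using nz by eventually_elim (rule phi.pos)
    then have "filterlim (\<lambda>r. t / \<phi> r) at_top (at 0)"
      using \<open>t > 0\<close> phi.tendsto_0 by (intro LIM_at_top_divide[OF tendsto_const]) auto
    then have "((\<lambda>r. N b (t / \<phi> r)) \<longlongrightarrow> 1) (at 0)"
      by (rule filterlim_compose[OF bN5_tendsto])
    moreover have "eventually (\<lambda>r. N (r *\<^sub>R b) t = N b (t / \<phi> r)) (at 0)"
      using nz by eventually_elim (metis bN3[OF \<open>t > 0\<close>] phi.pos less_irrefl)
    ultimately show "((\<lambda>r. N (r *\<^sub>R b) t) \<longlongrightarrow> 1) (at 0)"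
      by (simp add: tendsto_cong)
  qed
  \<comment> \<open>The coefficients \<open>c i\<close> may equal 0, so the punctured limit has to
    be extended to the point 0 itself.\<close>
  then have "null (\<lambda>r. r *\<^sub>R b) (nhds 0)"
    unfolding null_def by (auto simp: tendsto_nhds_iff N_zero)
  from null_compose[OF this assms] show ?thesis .
qed

section \<open>Cauchy sequences as null double sequences\<close>

lemma Cauchy_seq_diff:
  assumes "Cauchy_seq x" "Cauchy_seq y"
  shows "Cauchy_seq (\<lambda>n. x n - y n)"
  using null_diff[OF assms[unfolded Cauchy_seq_def]] unfolding Cauchy_seq_def
  by (simp add: algebra_simps)

lemma null_imp_Cauchy_seq:
  assumes "null (\<lambda>n. x n - l) sequentially"
  shows "Cauchy_seq x"
  using null_diff[OF null_compose[OF assms filterlim_fst] null_compose[OF assms filterlim_snd]]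
  unfolding Cauchy_seq_def by simp

text \<open>Uniformity in \<open>p\<close> yields one threshold for all pairs \<open>n < m\<close>;
  the symmetry \<open>N_uminus\<close> covers \<open>m < n\<close>.\<close>

lemma fuzzy_Cauchy_imp_Cauchy_seq:
  assumes "fuzzy_Cauchy N x"
  shows "Cauchy_seq x"
  unfolding Cauchy_seq_def null_def
proof (intro allI impI tendstoI)
  fix t e :: real assume "t > 0" "e > 0"
  have "eventually (\<lambda>n. \<forall>p\<in>{1..}. dist (N (x (n + p) - x n) t) 1 < e) sequentially"
    using assms \<open>t > 0\<close> \<open>e > 0\<close> unfolding fuzzy_Cauchy_def uniform_limit_iff by auto
  then obtain M where M: "dist (N (x (n + p) - x n) t) 1 < e" if "n \<ge> M" "p \<ge> 1" for n p
    unfolding eventually_sequentially by auto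
  have less: "dist (N (x m - x n) t) 1 < e" if "M \<le> n" "n < m" for m n
    using M[of n "m - n"] that by simp
  have "dist (N (x m - x n) t) 1 < e" if "M \<le> n" "M \<le> m" for m n
  proof (cases m n rule: linorder_cases)
    case less': less
    then show ?thesis
      using less[OF \<open>M \<le> m\<close>, of n] N_uminus[of "x m - x n" t] by simp
  qed (use less that N_zero \<open>t > 0\<close> \<open>e > 0\<close> in auto)
  then show "eventually (\<lambda>p. dist (N (x (fst p) - x (snd p)) t) 1 < e)
      (sequentially \<times>\<^sub>F sequentially)"
    unfolding eventually_prod_sequentially by auto
qed

section \<open>Completeness of finitely generated subspaces\<close>

text \<open>The premise \<open>complete\<close> has the shape of the induction hypothesis of
  \<open>complete_span\<close>.\<close>

lemma Cauchy_coefficient: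
  assumes complete: "\<And>w. \<lbrakk>Cauchy_seq w; range w \<subseteq> span B\<rbrakk>
      \<Longrightarrow> \<exists>l\<in>span B. null (\<lambda>n. w n - l) sequentially"
    and b: "b \<notin> span B"
    and x: "Cauchy_seq x" "\<And>n. x n - a n *\<^sub>R b \<in> span B"
  shows "Cauchy a"
proof (rule ccontr)
  assume "\<not> Cauchy a"
  then obtain e where e: "e > 0" "\<And>k. \<exists>m\<ge>k. \<exists>n\<ge>k. \<bar>a m - a n\<bar> \<ge> e"
    unfolding Cauchy_def dist_real_def by (meson not_less)
  then obtain m n where mn: "m k \<ge> k" "n k \<ge> k" "\<bar>a (m k) - a (n k)\<bar> \<ge> e" for k
    by metis
  define d where "d k = a (m k) - a (n k)" for k
  \<comment> \<open>Division by \<open>d k\<close> makes the coefficient of \<open>b\<close> equal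
    to 1, so subtracting \<open>b\<close> leaves an element of \<open>span B\<close>.\<close>
  define w where "w k = (x (m k) - x (n k)) /\<^sub>R d k - b" for k
  have d: "\<bar>d k\<bar> \<ge> e" "d k \<noteq> 0" for k
    using mn(3)[of k] \<open>e > 0\<close> by (auto simp: d_def)
  have "filterlim (\<lambda>k. (m k, n k)) (sequentially \<times>\<^sub>F sequentially) sequentially"
    using mn(1,2)
    by (intro filterlim_Pair filterlim_at_top_mono[OF filterlim_ident] always_eventually) auto
  from null_compose[OF x(1)[unfolded Cauchy_seq_def] this]
  have "null (\<lambda>k. x (m k) - x (n k)) sequentially" by simp
  moreover have "\<bar>inverse (d k)\<bar> \<le> inverse e" for k
    using d[of k] \<open>e > 0\<close> by (simp add: le_imp_inverse_le)
  ultimately have "null (\<lambda>k. (x (m k) - x (n k)) /\<^sub>R d k) sequentially"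
    using null_scaleR_bounded \<open>e > 0\<close> by (metis positive_imp_inverse_positive)
  then have w_null: "null (\<lambda>k. w k - (- b)) sequentially"
    by (simp add: w_def)
  have "w k \<in> span B" for k
  proof -
    have "w k = ((x (m k) - a (m k) *\<^sub>R b) - (x (n k) - a (n k) *\<^sub>R b) + d k *\<^sub>R b) /\<^sub>R d k - b"
      by (simp add: w_def d_def algebra_simps)
    also have "\<dots> = ((x (m k) - a (m k) *\<^sub>R b) - (x (n k) - a (n k) *\<^sub>R b)) /\<^sub>R d k"
      using d(2)[of k] by (simp add: scaleR_add_right)
    also have "\<dots> \<in> span B"
      by (intro span_scale span_diff x)
    finally show ?thesis .
  qed
  then obtain l where l: "l \<in> span B" "null (\<lambda>k. w k - l) sequentially"
    using complete[of w] null_imp_Cauchy_seq[OF w_null] by auto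
  \<comment> \<open>Uniqueness of limits: the difference of the two null sequences is
    constant.\<close>
  have "null (\<lambda>k::nat. b + l) sequentially"
    using null_diff[OF w_null l(2)] by simp
  then have "b = - l"
    using null_const[of "b + l" sequentially] by (simp add: eq_neg_iff_add_eq_0)
  then show False
    using b l(1) span_neg by blast
qed

lemma complete_span:
  assumes "finite B" "Cauchy_seq x" "range x \<subseteq> span B"
  shows "\<exists>l\<in>span B. null (\<lambda>n. x n - l) sequentially"
  using assms
proof (induction B arbitrary: x)
  case empty
  \<comment> \<open>Here \<open>x\<close> is identically 0; that the zero sequence is null is the
    case of zero coefficients.\<close>
  then show ?case
    using null_scaleR_left[of "\<lambda>_. 0" sequentially 0] by (auto simp: image_subset_iff)
next
  case (insert b B)
  show ?case
  proof (cases "b \<in> span B")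
    case True
    then show ?thesis
      using insert span_redundant by metis
  next
    case False
    have "\<forall>n. \<exists>a. x n - a *\<^sub>R b \<in> span B"
      using insert.prems(2) span_breakdown_eq by blast
    then obtain a where a: "x n - a n *\<^sub>R b \<in> span B" for n
      by metis
    have "Cauchy a"
      using Cauchy_coefficient[OF insert.IH False insert.prems(1) a] by blast
    then obtain L where "a \<longlonglongrightarrow> L"
      using Cauchy_convergent_iff convergent_def by blast
    then have "(\<lambda>n. a n - L) \<longlonglongrightarrow> 0"
      by (simp add: LIM_zero)
    then have ab: "null (\<lambda>n. a n *\<^sub>R b - L *\<^sub>R b) sequentially"
      using null_scaleR_left[of "\<lambda>n. a n - L" sequentially b] by (simp add: scaleR_diff_left)
    then have "Cauchy_seq (\<lambda>n. x n - a n *\<^sub>R b)"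
      by (intro Cauchy_seq_diff insert.prems null_imp_Cauchy_seq)
    then obtain l where l: "l \<in> span B" "null (\<lambda>n. x n - a n *\<^sub>R b - l) sequentially"
      using insert.IH[of "\<lambda>n. x n - a n *\<^sub>R b"] a by auto
    have "null (\<lambda>n. x n - (L *\<^sub>R b + l)) sequentially"
      using null_add[OF ab l(2)] by (simp add: algebra_simps)
    moreover have "L *\<^sub>R b + l \<in> span (insert b B)"
      using l(1) by (auto simp: span_breakdown_eq intro!: exI[of _ L])
    ultimately show ?thesis by blast
  qed
qed

end

theorem theorem4p2:
  fixes N :: "'a::real_vector \<Rightarrow> real \<Rightarrow> real"
    and \<phi> :: "real \<Rightarrow> real"
    and K :: real
    and T :: "real \<Rightarrow> real \<Rightarrow> real"
  assumes "fuzzy_strong_phi_b_normed_space N \<phi> K T"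
    and "\<exists>B::'a set. finite B \<and> span B = UNIV"
    and "continuous (at (1, 1) within {0..1} \<times> {0..1}) (\<lambda>(a, b). T a b)"
  shows "fuzzy_complete N"
proof -
  interpret fuzzy_normed_space_cont N \<phi> K T
    using assms by (simp add: fuzzy_normed_space_cont_def fuzzy_normed_space_cont_axioms_def)
  obtain B :: "'a set" where "finite B" "span B = UNIV"
    using assms(2) by blast
  then show ?thesis
    using complete_span[of B] fuzzy_Cauchy_imp_Cauchy_seq
    unfolding fuzzy_complete_def fuzzy_converges_def null_def by auto
qed

end
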